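(* Let $X$ be a real-valued random variable such that the function $$t \mapsto \Phi^{-1}\big(\mathbb{P}[X < t]\big)$$ is concave on $\mathbb{R}$. Then the function $\Lambda_X : \mathbb{R} \to \mathbb{R} \cup \{\infty\}$ defined by $$\Lambda_X(p) = \frac{1}{p} \log \mathbb{E}\, e^{pX}$$ (with $\Lambda_X(0) = \mathbb{E} X$) is convex, and moreover $\Lambda_X$ is strictly convex (on the set $\{\Lambda_X<\infty\}$) unless $X$ is Gaussian.
   Context: $\Phi(t) = \int_{-\infty}^t e^{-x^2/2}\,\frac{dx}{\sqrt{2\pi}}$ is the standard normal distribution function and $\Phi^{-1}$ its inverse, extended by $\Phi^{-1}(0) = -\infty$ and $\Phi^{-1}(1) = +\infty$. Concavity of an extended-real-valued function $G$ means $G((1-\lambda)s+\lambda t) \ge (1-\lambda)G(s) + \lambda G(t)$ for all $\lambda\in(0,1)$ and all $s,t$ with $G(s),G(t) > -\infty$. A real random variable is called Gaussian if it is an affine image $\sigma Z + \mu$ of a standard normal variable $Z$ (so constants are allowed as degenerate Gaussians). Convention: $\frac1p\log\mathbb{E}e^{pX}$ is read as $\mathbb{E}X$ when $p=0$. *)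

theory Defs
  imports "HOL-Probability.Probability"
begin

definition Phi :: "real \<Rightarrow> real" where
  "Phi t = (LINT x:{..t}|lborel. std_normal_density x)"

lemma Phi_eq_cdf: "Phi t = cdf std_normal_distribution t"
proof -
  have "cdf std_normal_distribution t
      = measure std_normal_distribution {..t}" by (simp add: cdf_def)
  also have "\<dots> = (LINT x|std_normal_distribution. indicat_real {..t} x)"
    by simp
  also have "\<dots> = (LINT x|lborel. std_normal_density x *\<^sub>R indicat_real {..t} x)"
    by (rule integral_density) auto
  also have "\<dots> = Phi t"
    unfolding Phi_def set_lebesgue_integral_def
    by (intro Bochner_Integration.integral_cong) auto
  finally show ?thesis by simp
qed

lemma real_distribution_std_normal: "real_distribution std_normal_distribution"
  unfolding real_distribution_def real_distribution_axioms_def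
  by (simp add: prob_space_normal_density)

lemma isCont_Phi: "isCont Phi t"
proof -
  interpret real_distribution std_normal_distribution by (rule real_distribution_std_normal)
  have "emeasure std_normal_distribution {t} = (\<integral>\<^sup>+ x. ennreal (std_normal_density x) * indicator {t} x \<partial>lborel)"
    by (rule emeasure_density) auto
  also have "\<dots> = 0"
    by (subst nn_integral_0_iff_AE) (auto intro: AE_I[where N = "{t}"] simp: indicator_def)
  finally have "measure std_normal_distribution {t} = 0" by (simp add: measure_def)
  then have "isCont (cdf std_normal_distribution) t" by (simp add: isCont_cdf)
  then show ?thesis by (simp add: Phi_eq_cdf[abs_def])
qed

lemma strict_mono_Phi: "strict_mono Phi"
proof (rule strict_monoI)
  fix s t :: real assume st: "s < t"
  interpret real_distribution std_normal_distribution by (rule real_distribution_std_normal)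
  have eq: "cdf std_normal_distribution t - cdf std_normal_distribution s = measure std_normal_distribution {s<..t}"
    using st by (rule cdf_diff_eq)
  have "measure std_normal_distribution {s<..t} \<noteq> 0"
  proof
    assume "measure std_normal_distribution {s<..t} = 0"
    then have "emeasure std_normal_distribution {s<..t} = 0"
      by (simp add: emeasure_eq_measure)
    moreover have "emeasure std_normal_distribution {s<..t} = (\<integral>\<^sup>+ x. ennreal (std_normal_density x) * indicator {s<..t} x \<partial>lborel)"
      by (rule emeasure_density) auto
    ultimately have "AE x in lborel. ennreal (std_normal_density x) * indicator {s<..t} x = 0"
      by (simp add: nn_integral_0_iff_AE)
    then have "AE x in lborel. x \<notin> {s<..t}"
      proof eventually_elim
      case (elim x)
      have "0 < std_normal_density x" by (rule normal_density_pos) simp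
      then show ?case using elim by (auto simp: indicator_def)
    qed
    then have "emeasure lborel {s<..t} = 0"
      by (subst (asm) AE_iff_measurable[where N = "{s<..t}"]) auto
    then show False using st by simp
  qed
  then have "measure std_normal_distribution {s<..t} > 0"
    using measure_nonneg[of std_normal_distribution "{s<..t}"] by linarith
  then show "Phi s < Phi t" using eq by (simp add: Phi_eq_cdf)
qed

lemma bij_betw_Phi: "bij_betw Phi UNIV {0<..<1}"
proof -
  interpret real_distribution std_normal_distribution by (rule real_distribution_std_normal)
  have top: "(Phi \<longlongrightarrow> 1) at_top" and bot: "(Phi \<longlongrightarrow> 0) at_bot"
    using cdf_lim_at_top_prob cdf_lim_at_bot by (simp_all add: Phi_eq_cdf[abs_def])
  have le: "0 \<le> Phi t" "Phi t \<le> 1" for t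
    by (simp_all add: Phi_eq_cdf cdf_nonneg cdf_bounded_prob)
  have "0 < Phi t" "Phi t < 1" for t
    using le(1)[of "t - 1"] le(2)[of "t + 1"]
      strict_monoD[OF strict_mono_Phi, of "t - 1" t] strict_monoD[OF strict_mono_Phi, of t "t + 1"]
    by linarith+
  moreover have "u \<in> range Phi" if u: "0 < u" "u < 1" for u
  proof -
    obtain a where a: "Phi a < u"
      using order_tendstoD(2)[OF bot u(1)] by (auto simp: eventually_at_bot_linorder)
    obtain b where b: "u < Phi b"
      using order_tendstoD(1)[OF top u(2)] by (auto simp: eventually_at_top_linorder)
    have "a \<le> b" using a b strict_mono_less_eq[OF strict_mono_Phi, of b a] by linarith
    then obtain x where "Phi x = u"
      using IVT[of Phi a u b] a b isCont_Phi by auto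
    then show ?thesis by auto
  qed
  ultimately show ?thesis
    using strict_mono_imp_inj_on[OF strict_mono_Phi] by (auto simp: bij_betw_def)
qed

definition Phi_inv :: "real \<Rightarrow> ereal" where
  "Phi_inv u = (if u \<le> 0 then - \<infinity> else if u \<ge> 1 then \<infinity> else ereal (inv Phi u))"

text \<open>
  Concavity of functions with values in \<open>[-\<infinity>, \<infinity>]\<close>, and dually convexity. The restriction
  on \<open>s\<close> and \<open>t\<close> excludes every sum of the form \<open>\<infinity> - \<infinity>\<close>.
\<close>

definition ext_concave :: "(real \<Rightarrow> ereal) \<Rightarrow> bool" where
  "ext_concave G \<longleftrightarrow>
    (\<forall>l\<in>{0<..<1}. \<forall>s t. G s > - \<infinity> \<longrightarrow> G t > - \<infinity> \<longrightarrow>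
      G ((1 - l) * s + l * t) \<ge> ereal (1 - l) * G s + ereal l * G t)"

definition ext_convex :: "(real \<Rightarrow> ereal) \<Rightarrow> bool" where
  "ext_convex f \<longleftrightarrow>
    (\<forall>l\<in>{0<..<1}. \<forall>p q. f p < \<infinity> \<longrightarrow> f q < \<infinity> \<longrightarrow>
      f ((1 - l) * p + l * q) \<le> ereal (1 - l) * f p + ereal l * f q)"

definition ext_strictly_convex_on :: "real set \<Rightarrow> (real \<Rightarrow> ereal) \<Rightarrow> bool" where
  "ext_strictly_convex_on S f \<longleftrightarrow> convex S \<and>
    (\<forall>l\<in>{0<..<1}. \<forall>p\<in>S. \<forall>q\<in>S. p \<noteq> q \<longrightarrow>
      f ((1 - l) * p + l * q) < ereal (1 - l) * f p + ereal l * f q)"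

text \<open>
  The Bochner integral is 0 for non-integrable functions, so expectations are taken as
  nonnegative integrals with values in \<open>[0, \<infinity>]\<close>. The value \<open>- \<infinity>\<close> is assigned to an
  expectation whose negative part is infinite, including the undefined case where the positive
  part is infinite as well; thus \<open>ext_expectation M X > - \<infinity>\<close> says that the expectation is
  well defined with a value in \<open>(-\<infinity>, \<infinity>]\<close>.
\<close>

definition ext_expectation :: "'a measure \<Rightarrow> ('a \<Rightarrow> real) \<Rightarrow> ereal" where
  "ext_expectation M X =
    (if (\<integral>\<^sup>+ \<omega>. ennreal (- X \<omega>) \<partial>M) = \<infinity> then - \<infinity>
     else enn2ereal (\<integral>\<^sup>+ \<omega>. ennreal (X \<omega>) \<partial>M) - enn2ereal (\<integral>\<^sup>+ \<omega>. ennreal (- X \<omega>) \<partial>M))"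

definition ext_ln :: "ennreal \<Rightarrow> ereal" where
  "ext_ln x = (if x = 0 then - \<infinity> else if x = \<infinity> then \<infinity> else ereal (ln (enn2real x)))"

definition Lambda :: "'a measure \<Rightarrow> ('a \<Rightarrow> real) \<Rightarrow> real \<Rightarrow> ereal" where
  "Lambda M X p =
    (if p = 0 then ext_expectation M X
     else ereal (1 / p) * ext_ln (\<integral>\<^sup>+ \<omega>. ennreal (exp (p * X \<omega>)) \<partial>M))"

text \<open>
  Being Gaussian is a property of the law of \<open>X\<close>: the space \<open>M\<close> need not carry a standard normal
  variable when \<open>\<sigma> = 0\<close>.
\<close>

definition gaussian :: "'a measure \<Rightarrow> ('a \<Rightarrow> real) \<Rightarrow> bool" where
  "gaussian M X \<longleftrightarrow>
    (\<exists>\<sigma> \<mu>. distr M borel X = distr std_normal_distribution borel (\<lambda>z. \<sigma> * z + \<mu>))"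

end

theory Submission
  imports Defs
begin

text \<open>
  If \<open>Y = a Z + b\<close> with \<open>Z\<close> standard normal and \<open>a > 0\<close>, then \<open>\<Lambda>\<^sub>Y(q) = b + a\<^sup>2 q / 2\<close> is affine in
  \<open>q\<close>. Given \<open>p < q < r\<close> with \<open>\<Lambda>\<^sub>X\<close> finite at \<open>p\<close> and \<open>r\<close>, and \<open>X\<close> not constant, \<open>\<Lambda>\<^sub>X\<close> is strictly
  increasing, so there is such a \<open>Y\<close> with \<open>\<Lambda>\<^sub>Y = \<Lambda>\<^sub>X\<close> at \<open>p\<close> and \<open>r\<close>; the claim becomes
  \<open>\<Lambda>\<^sub>X(q) \<le> \<Lambda>\<^sub>Y(q)\<close>. Put \<open>h(t) = P[Y < t] - P[X < t]\<close>. By Fubini, the sign of \<open>\<Lambda>\<^sub>X(s) - \<Lambda>\<^sub>Y(s)\<close> is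
  that of \<open>\<integral> e\<^bsup>st\<^esup> h(t) dt\<close>, which vanishes for \<open>s = p\<close> and \<open>s = r\<close>. As \<open>\<Phi>\<^sup>-\<^sup>1(P[X < t])\<close> is concave and
  \<open>\<Phi>\<^sup>-\<^sup>1(P[Y < t])\<close> is affine, \<open>{h < 0}\<close> is an interval. If it has at most one
  point, \<open>\<integral> e\<^bsup>pt\<^esup> h(t) dt = 0\<close> already forces \<open>h = 0\<close> almost everywhere. Otherwise some combination
  \<open>e\<^bsup>qt\<^esup> - \<alpha> e\<^bsup>pt\<^esup> - \<beta> e\<^bsup>rt\<^esup>\<close> is positive inside this interval and negative outside it, so integrating it
  against \<open>h\<close> gives \<open>\<integral> e\<^bsup>qt\<^esup> h(t) dt < 0\<close> unless \<open>h = 0\<close> almost everywhere, that is, unless \<open>X\<close> and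
  \<open>Y\<close> have the same law.
\<close>

section \<open>Exponential primitives and tail integrals\<close>

text \<open>
  The normalisation makes \<open>Lambda M X q = c\<close> equivalent to
  \<open>E (exp_prim q X) = exp_prim q c\<close> for every \<open>q\<close>, including \<open>q = 0\<close>.
\<close>

definition exp_prim :: "real \<Rightarrow> real \<Rightarrow> real" where
  "exp_prim q x = (if q = 0 then x else (exp (q * x) - 1) / q)"

lemma exp_prim_0 [simp]: "exp_prim q 0 = 0"
  by (simp add: exp_prim_def)

lemma DERIV_exp_prim: "(exp_prim q has_real_derivative exp (q * x)) (at x)"
proof (cases "q = 0")
  case False
  have "((\<lambda>x. (exp (q * x) - 1) / q) has_real_derivative exp (q * x)) (at x)"
    using False by (auto intro!: derivative_eq_intros)
  with False show ?thesis by (simp add: exp_prim_def[abs_def])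
qed (simp add: exp_prim_def[abs_def])

lemma borel_measurable_exp_prim [measurable]: "exp_prim q \<in> borel_measurable borel"
  unfolding exp_prim_def[abs_def] by measurable

lemma strict_mono_exp_prim: "strict_mono (exp_prim q)"
proof (rule strict_monoI)
  fix x y :: real
  assume "x < y"
  then show "exp_prim q x < exp_prim q y"
    by (rule DERIV_pos_imp_increasing) (use DERIV_exp_prim exp_gt_zero in blast)
qed

lemmas exp_prim_less_iff = strict_mono_less[OF strict_mono_exp_prim]
  and exp_prim_le_iff = strict_mono_less_eq[OF strict_mono_exp_prim]
  and exp_prim_eq_iff = strict_mono_eq[OF strict_mono_exp_prim]

text \<open>Moves the base point of the primitive from 0 to \<open>c\<close>, so that a comparison
  of exponents around \<open>c\<close> reduces to one around 0.\<close>

lemma exp_prim_shift: "exp_prim q x = exp_prim q c + exp (q * c) * exp_prim q (x - c)"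
proof -
  have "exp (q * c) * exp (q * (x - c)) = exp (q * x)"
    unfolding exp_add[symmetric] by (simp add: algebra_simps)
  then have "exp (q * c) * (exp (q * (x - c)) - 1) = exp (q * x) - exp (q * c)"
    by (simp only: right_diff_distrib mult_1_right)
  then show ?thesis by (simp add: exp_prim_def flip: add_divide_distrib)
qed

text \<open>The difference of the two sides vanishes at 0, and its derivative
  \<open>exp (r * x) - exp (p * x)\<close> has the sign of \<open>x\<close>.\<close>

lemma exp_prim_less_param:
  assumes "p < r" "y \<noteq> 0"
  shows "exp_prim p y < exp_prim r y"
proof -
  let ?g = "\<lambda>y. exp_prim r y - exp_prim p y"
  have D: "(?g has_real_derivative (exp (r * x) - exp (p * x))) (at x)" for x
    by (rule DERIV_diff[OF DERIV_exp_prim DERIV_exp_prim])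
  consider "0 < y" | "y < 0" using assms by linarith
  then have "0 < ?g y"
  proof cases
    case 1
    then obtain z where "0 < z" "z < y" "?g y - ?g 0 = (y - 0) * (exp (r * z) - exp (p * z))"
      using MVT2[OF 1 D] by blast
    with 1 assms show ?thesis by simp
  next
    case 2
    then obtain z where "y < z" "z < 0" "?g 0 - ?g y = (0 - y) * (exp (r * z) - exp (p * z))"
      using MVT2[OF 2 D] by blast
    moreover from this have "(0 - y) * (exp (r * z) - exp (p * z)) < 0"
      using assms by (intro mult_pos_neg) auto
    ultimately show ?thesis by simp
  qed
  then show ?thesis by simp
qed

lemma exp_prim_le_param: "p \<le> r \<Longrightarrow> exp_prim p y \<le> exp_prim r y"
  using exp_prim_less_param[of p r y] by (cases "y = 0"; cases "p = r") auto

text \<open>This is the integral of \<open>exp (q * t)\<close> from 0 to \<open>x\<close>: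
  \<open>k\<close> is 1 on (0, x] or -1 on (x, 0]. Half-line indicators are used because averaging
  the second one over a random \<open>x\<close> yields P[X < t]. As \<open>k\<close> has constant
  sign, the absolute version also holds; Fubini needs it.\<close>

lemma has_bochner_integral_exp_prim:
  fixes x :: real
  defines "k \<equiv> \<lambda>t. indicat_real {0<..} t - indicat_real {x<..} t"
  shows "has_bochner_integral lborel (\<lambda>t. exp (q * t) * k t) (exp_prim q x)"
    and "has_bochner_integral lborel (\<lambda>t. \<bar>exp (q * t) * k t\<bar>) \<bar>exp_prim q x\<bar>"
proof -
  have F: "has_bochner_integral lborel (\<lambda>t. exp (q * t) * indicator {a..b} t) (exp_prim q b - exp_prim q a)"
    if "a \<le> b" for a b
    using that by (intro has_bochner_integral_FTC_Icc_real DERIV_exp_prim) auto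
  have [measurable]: "k \<in> borel_measurable borel" unfolding k_def by measurable
  have A: "AE t in lborel. t \<noteq> 0 \<and> t \<noteq> x"
    using AE_lborel_singleton[of 0] AE_lborel_singleton[of x] by eventually_elim auto
  have "has_bochner_integral lborel (\<lambda>t. exp (q * t) * k t) (exp_prim q x) \<and>
    has_bochner_integral lborel (\<lambda>t. \<bar>exp (q * t) * k t\<bar>) \<bar>exp_prim q x\<bar>"
  proof (cases "0 \<le> x")
    case True
    have "0 \<le> exp_prim q x" using True exp_prim_le_iff[of q 0 x] by simp
    then have h: "has_bochner_integral lborel (\<lambda>t. exp (q * t) * indicator {0..x} t) (exp_prim q x)"
      using F[OF True] by simp
    have "AE t in lborel. exp (q * t) * k t = exp (q * t) * indicator {0..x} t"
      using A by eventually_elim (use True in \<open>auto simp: k_def indicator_def\<close>)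
    with h have 1: "has_bochner_integral lborel (\<lambda>t. exp (q * t) * k t) (exp_prim q x)"
      by (subst has_bochner_integral_cong_AE) auto
    have "\<bar>exp (q * t) * k t\<bar> = exp (q * t) * k t" for t
      using True by (auto simp: k_def indicator_def)
    with 1 \<open>0 \<le> exp_prim q x\<close> show ?thesis by simp
  next
    case False
    have "exp_prim q x \<le> 0" using False exp_prim_le_iff[of q x 0] by simp
    have h: "has_bochner_integral lborel (\<lambda>t. exp (q * t) * indicator {x..0} t) (- exp_prim q x)"
      using F[of x 0] False by simp
    have "AE t in lborel. - (exp (q * t) * k t) = exp (q * t) * indicator {x..0} t"
      using A by eventually_elim (use False in \<open>auto simp: k_def indicator_def\<close>)
    with h have 1: "has_bochner_integral lborel (\<lambda>t. - (exp (q * t) * k t)) (- exp_prim q x)"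
      by (subst has_bochner_integral_cong_AE) auto
    have "\<bar>exp (q * t) * k t\<bar> = - (exp (q * t) * k t)" for t
      using False by (auto simp: k_def indicator_def)
    with 1 has_bochner_integral_minus[OF 1] \<open>exp_prim q x \<le> 0\<close> show ?thesis by simp
  qed
  then show "has_bochner_integral lborel (\<lambda>t. exp (q * t) * k t) (exp_prim q x)"
    "has_bochner_integral lborel (\<lambda>t. \<bar>exp (q * t) * k t\<bar>) \<bar>exp_prim q x\<bar>" by auto
qed

section \<open>Exponential moments as integrals of the distribution function\<close>

abbreviation prob_less :: "'a measure \<Rightarrow> ('a \<Rightarrow> real) \<Rightarrow> real \<Rightarrow> real" where
  "prob_less M X t \<equiv> measure M {\<omega> \<in> space M. X \<omega> < t}"

context prob_space
begin

text \<open>Fubini applied to the integral representation of \<open>exp_prim q (X \<omega>)\<close>.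
  The term \<open>indicator {0<..} t\<close> does not depend on the law and cancels when two laws
  are compared.\<close>

lemma has_bochner_integral_tail_exp_prim:
  assumes X [measurable]: "X \<in> borel_measurable M"
    and int: "integrable M (\<lambda>\<omega>. exp_prim q (X \<omega>))"
  shows "has_bochner_integral lborel (\<lambda>t. exp (q * t) * (indicator {0<..} t - prob_less M X t))
    (expectation (\<lambda>\<omega>. exp_prim q (X \<omega>)))"
proof -
  define f where "f \<omega> t = exp (q * t) * (indicat_real {0<..} t - indicat_real {X \<omega><..} t)" for \<omega> t
  interpret pair_sigma_finite M lborel ..
  have m [measurable]: "case_prod f \<in> borel_measurable (M \<Otimes>\<^sub>M lborel)"
    unfolding f_def[abs_def] indicator_def greaterThan_iff by measurable
  have I: "integrable (M \<Otimes>\<^sub>M lborel) (case_prod f)"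
  proof (rule Fubini_integrable[OF m])
    show "integrable M (\<lambda>\<omega>. \<integral>t. norm (case_prod f (\<omega>, t)) \<partial>lborel)"
      using has_bochner_integral_integral_eq[OF has_bochner_integral_exp_prim(2)] int
      by (simp add: f_def)
    show "AE \<omega> in M. integrable lborel (\<lambda>t. case_prod f (\<omega>, t))"
      using has_bochner_integral_exp_prim(1) by (auto simp: f_def has_bochner_integral_iff)
  qed
  have E: "(\<integral>\<omega>. f \<omega> t \<partial>M) = exp (q * t) * (indicator {0<..} t - prob_less M X t)" for t
  proof -
    have "(\<integral>\<omega>. indicat_real {X \<omega><..} t \<partial>M) = (\<integral>\<omega>. indicat_real {\<omega>\<in>space M. X \<omega> < t} \<omega> \<partial>M)"
      by (intro Bochner_Integration.integral_cong) (auto simp: indicator_def)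
    also have "\<dots> = prob_less M X t" by simp
    finally have e: "(\<integral>\<omega>. indicat_real {X \<omega><..} t \<partial>M) = prob_less M X t" .
    have "integrable M (\<lambda>\<omega>. indicat_real {X \<omega><..} t)"
      unfolding indicator_def greaterThan_iff
      by (rule integrable_const_bound[where B = 1]) auto
    then show ?thesis by (simp add: f_def e prob_space)
  qed
  have "(\<integral>\<omega>. (\<integral>t. f \<omega> t \<partial>lborel) \<partial>M) = expectation (\<lambda>\<omega>. exp_prim q (X \<omega>))"
    using has_bochner_integral_integral_eq[OF has_bochner_integral_exp_prim(1)] by (simp add: f_def)
  with integrable_snd[OF I] Fubini_integral[OF I] show ?thesis
    by (simp add: E has_bochner_integral_iff)
qed

text \<open>For negative \<open>p\<close>, \<open>exp (p * x)\<close> is the integral of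
  \<open>- p * exp (p * t)\<close> over t > x. Tonelli applies without integrability, so the formula
  can serve to prove that a moment is finite.\<close>

lemma nn_integral_exp_neg:
  assumes [measurable]: "X \<in> borel_measurable M" and p: "p < 0"
  shows "(\<integral>\<^sup>+\<omega>. ennreal (exp (p * X \<omega>)) \<partial>M) =
    (\<integral>\<^sup>+t. ennreal (- p * exp (p * t)) * ennreal (prob_less M X t) \<partial>lborel)"
proof -
  interpret pair_sigma_finite M lborel ..
  have e: "ennreal (exp (p * x)) = (\<integral>\<^sup>+t. ennreal (- p * exp (p * t)) * indicator {x<..} t \<partial>lborel)" for x
  proof -
    have lim: "((\<lambda>t. - exp (p * t)) \<longlongrightarrow> - 0) at_top"
      by (intro tendsto_minus filterlim_compose[OF exp_at_bot]
          filterlim_tendsto_neg_mult_at_bot[OF tendsto_const p filterlim_ident])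
    have "(\<integral>\<^sup>+t. ennreal (- p * exp (p * t)) * indicator {x..} t \<partial>lborel) = ennreal (- 0 - (- exp (p * x)))"
      using p by (intro nn_integral_FTC_atLeast lim)
        (auto intro!: derivative_eq_intros mult_nonpos_nonneg)
    also have "(\<integral>\<^sup>+t. ennreal (- p * exp (p * t)) * indicator {x..} t \<partial>lborel) =
      (\<integral>\<^sup>+t. ennreal (- p * exp (p * t)) * indicator {x<..} t \<partial>lborel)"
      using AE_lborel_singleton[of x]
      by (intro nn_integral_cong_AE, eventually_elim) (auto simp: indicator_def)
    finally show ?thesis by simp
  qed
  have i: "indicator {X \<omega><..} t = indicator {\<omega>\<in>space M. X \<omega> < t} \<omega>" if "\<omega> \<in> space M" for \<omega> t
    using that by (auto simp: indicator_def)
  have "(\<integral>\<^sup>+\<omega>. ennreal (exp (p * X \<omega>)) \<partial>M) =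
    (\<integral>\<^sup>+\<omega>. (\<integral>\<^sup>+t. ennreal (- p * exp (p * t)) * indicator {X \<omega><..} t \<partial>lborel) \<partial>M)"
    by (simp add: e)
  also have "\<dots> = (\<integral>\<^sup>+t. (\<integral>\<^sup>+\<omega>. ennreal (- p * exp (p * t)) * indicator {X \<omega><..} t \<partial>M) \<partial>lborel)"
    unfolding indicator_def greaterThan_iff by (rule Fubini'[symmetric]) measurable
  also have "\<dots> = (\<integral>\<^sup>+t. (\<integral>\<^sup>+\<omega>. ennreal (- p * exp (p * t)) * indicator {\<omega>\<in>space M. X \<omega> < t} \<omega> \<partial>M) \<partial>lborel)"
    by (intro nn_integral_cong) (simp add: i cong: nn_integral_cong)
  also have "\<dots> = (\<integral>\<^sup>+t. ennreal (- p * exp (p * t)) * ennreal (prob_less M X t) \<partial>lborel)"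
    by (subst nn_integral_cmult_indicator) (auto simp: emeasure_eq_measure)
  finally show ?thesis .
qed

end

section \<open>Gaussian laws\<close>

text \<open>Completing the square turns the weighted density into a multiple of the normal density
  with mean \<open>s\<close>.\<close>

lemma has_bochner_integral_exp_std_normal:
  "has_bochner_integral std_normal_distribution (\<lambda>z. exp (s * z)) (exp (s\<^sup>2 / 2))"
proof (rule has_bochner_integral_density)
  have "std_normal_density z * exp (s * z) = exp (s\<^sup>2 / 2) * normal_density s 1 z" for z
    by (simp add: normal_density_def power2_eq_square field_simps flip: exp_add)
  moreover have "has_bochner_integral lborel (\<lambda>z. exp (s\<^sup>2 / 2) * normal_density s 1 z) (exp (s\<^sup>2 / 2) * 1)"
    by (intro has_bochner_integral_mult_right) (simp add: has_bochner_integral_iff)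
  ultimately show "has_bochner_integral lborel (\<lambda>z. std_normal_density z *\<^sub>R exp (s * z)) (exp (s\<^sup>2 / 2))"
    by simp
qed auto

lemma has_bochner_integral_exp_prim_gaussian:
  "has_bochner_integral std_normal_distribution (\<lambda>z. exp_prim q (a * z + b)) (exp_prim q (b + a\<^sup>2 * q / 2))"
proof -
  interpret prob_space std_normal_distribution by (rule prob_space_normal_density) simp
  have one: "has_bochner_integral std_normal_distribution (\<lambda>z. c) c" for c :: real
    using prob_space by (simp add: has_bochner_integral_iff)
  show ?thesis
  proof (cases "q = 0")
    case True
    have "has_bochner_integral std_normal_distribution (\<lambda>z. z) 0"
      using std_normal_moment_odd[of 0] by (intro has_bochner_integral_density) auto
    then have "has_bochner_integral std_normal_distribution (\<lambda>z. a * z + b) (a * 0 + b)"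
      by (intro has_bochner_integral_add has_bochner_integral_mult_right one)
    with True show ?thesis by (simp add: exp_prim_def)
  next
    case False
    have "has_bochner_integral std_normal_distribution (\<lambda>z. (exp (q * b) * exp (q * a * z) - 1) / q)
      ((exp (q * b) * exp ((q * a)\<^sup>2 / 2) - 1) / q)"
      by (intro has_bochner_integral_diff has_bochner_integral_divide_zero has_bochner_integral_mult_right
          has_bochner_integral_exp_std_normal one)
    with False show ?thesis
      by (simp add: exp_prim_def power2_eq_square algebra_simps flip: exp_add)
  qed
qed

text \<open>Continuity of \<open>Phi\<close> excludes atoms, so strict and non-strict inequalities
  give the same probability.\<close>

lemma
  assumes "0 < a"
  shows prob_less_gaussian: "prob_less std_normal_distribution (\<lambda>z. a * z + b) t = Phi ((t - b) / a)"
    and cdf_gaussian: "cdf (distr std_normal_distribution borel (\<lambda>z. a * z + b)) t = Phi ((t - b) / a)"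
proof -
  interpret real_distribution std_normal_distribution by (rule real_distribution_std_normal)
  let ?x = "(t - b) / a"
  have "isCont (cdf std_normal_distribution) ?x"
    using isCont_Phi by (simp add: Phi_eq_cdf[abs_def])
  then have "measure std_normal_distribution {?x} = 0"
    by (simp add: isCont_cdf)
  moreover have "measure std_normal_distribution ({..<?x} \<union> {?x}) =
      measure std_normal_distribution {..<?x} + measure std_normal_distribution {?x}"
    by (intro finite_measure_Union) auto
  moreover have "{..<?x} \<union> {?x} = {..?x}" by auto
  ultimately have "measure std_normal_distribution {..<?x} = Phi ?x"
    by (simp add: Phi_eq_cdf cdf_def2)
  moreover have "{z. a * z + b < t} = {..<?x}"
    using assms by (auto simp: field_simps)
  ultimately show "prob_less std_normal_distribution (\<lambda>z. a * z + b) t = Phi ?x"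
    by simp
  have "(\<lambda>z. a * z + b) -` {..t} = {..?x}"
    using assms by (auto simp: field_simps)
  then show "cdf (distr std_normal_distribution borel (\<lambda>z. a * z + b)) t = Phi ?x"
    by (simp add: cdf_def measure_distr Phi_eq_cdf)
qed

section \<open>Recognising Gaussian laws, including constants\<close>

lemma AE_lborel_obtain_between:
  fixes a b :: real
  assumes "AE t in lborel. P t" "a < b"
  obtains t where "a < t" "t < b" "P t"
proof -
  have "\<not> (\<forall>t\<in>{a<..<b}. \<not> P t)"
  proof
    assume *: "\<forall>t\<in>{a<..<b}. \<not> P t"
    from assms(1) have "AE t in lborel. t \<notin> {a<..<b}"
      by eventually_elim (use * in blast)
    then have "emeasure lborel {a<..<b} = 0"
      by (subst (asm) AE_iff_measurable[where N = "{a<..<b}"]) auto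
    with assms(2) show False by simp
  qed
  with that show thesis by auto
qed

text \<open>For s < t < u, P[X \<le> t] lies between P[X < s] and P[X < u]. Points \<open>s\<close>
  and \<open>u\<close> where the almost-everywhere equality holds exist arbitrarily close to
  \<open>t\<close>, and continuity of \<open>g\<close> closes the gap.\<close>

lemma (in prob_space) cdf_eq_of_AE_prob_less_eq:
  assumes X [measurable]: "X \<in> borel_measurable M"
    and ae: "AE t in lborel. prob_less M X t = g t" and g: "isCont g t"
  shows "cdf (distr M borel X) t = g t"
proof -
  have c: "cdf (distr M borel X) t = prob {\<omega>\<in>space M. X \<omega> \<le> t}"
    by (simp add: cdf_def measure_distr vimage_def Int_def conj_commute)
  have "\<bar>cdf (distr M borel X) t - g t\<bar> \<le> e" if "0 < e" for e
  proof -
    obtain d where d: "0 < d" "\<And>s. \<bar>s - t\<bar> < d \<Longrightarrow> \<bar>g s - g t\<bar> < e"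
      using g[unfolded continuous_at_eps_delta] \<open>0 < e\<close> by (auto simp: dist_real_def)
    obtain s where s: "t - d < s" "s < t" "prob_less M X s = g s"
      using AE_lborel_obtain_between[OF ae, of "t - d" t] d by auto
    obtain u where u: "t < u" "u < t + d" "prob_less M X u = g u"
      using AE_lborel_obtain_between[OF ae, of t "t + d"] d by auto
    have "prob_less M X s \<le> prob {\<omega>\<in>space M. X \<omega> \<le> t}"
      using s by (intro finite_measure_mono) auto
    moreover have "prob {\<omega>\<in>space M. X \<omega> \<le> t} \<le> prob_less M X u"
      using u by (intro finite_measure_mono) auto
    moreover have "\<bar>g s - g t\<bar> < e" "\<bar>g u - g t\<bar> < e" using d s u by auto
    ultimately show ?thesis using c s u by linarith
  qed
  then have "\<bar>cdf (distr M borel X) t - g t\<bar> \<le> 0"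
    by (rule field_le_epsilon) simp
  then show ?thesis by simp
qed

lemma (in prob_space) gaussianI:
  assumes X [measurable]: "X \<in> borel_measurable M" and "0 < a"
    and ae: "AE t in lborel. prob_less M X t = Phi ((t - b) / a)"
  shows "gaussian M X"
proof -
  interpret N: prob_space std_normal_distribution by (rule prob_space_normal_density) simp
  have "isCont (\<lambda>t. Phi ((t - b) / a)) t" for t
    by (rule isCont_o2[OF _ isCont_Phi]) (use \<open>0 < a\<close> in auto)
  then have "cdf (distr M borel X) = cdf (distr std_normal_distribution borel (\<lambda>z. a * z + b))"
    using cdf_eq_of_AE_prob_less_eq[OF X ae] cdf_gaussian[OF \<open>0 < a\<close>] by auto
  moreover have "real_distribution (distr M borel X)" by (rule real_distribution_distr) fact
  moreover have "real_distribution (distr std_normal_distribution borel (\<lambda>z. a * z + b))"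
    by (rule N.real_distribution_distr) measurable
  ultimately show ?thesis unfolding gaussian_def using cdf_unique by blast
qed

lemma (in prob_space) gaussian_of_AE_const:
  assumes [measurable]: "X \<in> borel_measurable M" and "AE \<omega> in M. X \<omega> = c"
  shows "gaussian M X"
proof -
  interpret N: prob_space std_normal_distribution by (rule prob_space_normal_density) simp
  have "distr M borel X = distr M borel (\<lambda>_. c)"
    using assms by (intro distr_cong_AE) auto
  also have "\<dots> = return borel c"
    by (rule distr_const) simp
  also have "\<dots> = distr std_normal_distribution borel (\<lambda>z. 0 * z + c)"
    using N.distr_const[of c borel] by simp
  finally show ?thesis unfolding gaussian_def by blast
qed

section \<open>Sign changes against exponential sums\<close>

text \<open>The exponential sum is chosen to equal 1 at each finite endpoint of \<open>I\<close>.
  The exceptional points \<open>t\<^sub>1\<close> and \<open>t\<^sub>2\<close> are these endpoints,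
  which may or may not belong to \<open>I\<close>.\<close>

lemma exp_sum_separates_interval:
  fixes I :: "real set"
  assumes "A > 0" "B > 0" and I: "is_interval I" and xy: "x \<in> I" "y \<in> I" "x < y"
  obtains \<alpha> \<beta> t\<^sub>1 t\<^sub>2 where
    "\<And>t. t \<noteq> t\<^sub>1 \<Longrightarrow> t \<noteq> t\<^sub>2 \<Longrightarrow> t \<in> I \<Longrightarrow> \<alpha> * exp (- A * t) + \<beta> * exp (B * t) < 1"
    "\<And>t. t \<noteq> t\<^sub>1 \<Longrightarrow> t \<noteq> t\<^sub>2 \<Longrightarrow> t \<notin> I \<Longrightarrow> \<alpha> * exp (- A * t) + \<beta> * exp (B * t) > 1"
proof -
  have mem: "t \<in> I" if "u \<in> I" "v \<in> I" "u \<le> t" "t \<le> v" for t u v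
    using I that unfolding is_interval_1 by blast
  \<comment> \<open>The conditional premises here and below treat an unbounded side as an infinite
    endpoint, where \<open>Inf I\<close> or \<open>Sup I\<close> carries no information.\<close>
  have lo: "\<exists>u\<in>I. u < t" if "bdd_below I \<Longrightarrow> Inf I < t" for t
  proof (rule ccontr)
    assume "\<not> (\<exists>u\<in>I. u < t)"
    then have *: "\<And>u. u \<in> I \<Longrightarrow> t \<le> u" by force
    then have "bdd_below I" by (rule bdd_belowI)
    moreover have "t \<le> Inf I" using * xy by (intro cInf_greatest) auto
    ultimately show False using that by simp
  qed
  have hi: "\<exists>v\<in>I. t < v" if "bdd_above I \<Longrightarrow> t < Sup I" for t
  proof (rule ccontr)
    assume "\<not> (\<exists>v\<in>I. t < v)"
    then have *: "\<And>v. v \<in> I \<Longrightarrow> v \<le> t" by force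
    then have "bdd_above I" by (rule bdd_aboveI)
    moreover have "Sup I \<le> t" using * xy by (intro cSup_least) auto
    ultimately show False using that by simp
  qed
  have inI: "t \<in> I" if "bdd_below I \<Longrightarrow> Inf I < t" "bdd_above I \<Longrightarrow> t < Sup I" for t
    using lo[OF that(1)] hi[OF that(2)] mem less_imp_le by blast
  consider (none) "\<not> bdd_below I" "\<not> bdd_above I" | (below) "bdd_below I" "\<not> bdd_above I"
    | (above) "\<not> bdd_below I" "bdd_above I" | (both) "bdd_below I" "bdd_above I" by metis
  then show thesis
  proof cases
    case none
    show thesis by (rule that[of 0 0 0 0]) (use none inI in auto)
  next
    case below
    \<comment> \<open>With a single finite endpoint one exponential suffices, scaled to cross 1
      there.\<close>
    have "exp (A * Inf I) * exp (- A * t) = exp (A * (Inf I - t))" for t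
      by (simp add: algebra_simps flip: exp_add)
    moreover have "t \<in> I \<Longrightarrow> Inf I \<le> t" for t using below by (auto intro: cInf_lower)
    ultimately show thesis
      using below inI \<open>0 < A\<close>
      by (intro that[of "Inf I" "Inf I" "exp (A * Inf I)" 0])
        (force simp: mult_less_0_iff zero_less_mult_iff)+
  next
    case above
    have "exp (- B * Sup I) * exp (B * t) = exp (B * (t - Sup I))" for t
      by (simp add: algebra_simps flip: exp_add)
    moreover have "t \<in> I \<Longrightarrow> t \<le> Sup I" for t using above by (auto intro: cSup_upper)
    ultimately show thesis
      using above inI \<open>0 < B\<close>
      by (intro that[of "Sup I" "Sup I" 0 "exp (- B * Sup I)"])
        (force simp: mult_less_0_iff zero_less_mult_iff)+
  next
    case both
    define a b where "a = Inf I" and "b = Sup I"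
    have "a \<le> x" "y \<le> b"
      unfolding a_def b_def using both xy by (auto intro: cInf_lower cSup_upper)
    then have "a < b" using xy by simp
    \<comment> \<open>Cramer's rule for the two equations \<open>k a = 1\<close> and
      \<open>k b = 1\<close> below; \<open>D\<close> is the determinant of the system.\<close>
    define D where "D = exp (- A * a) * exp (B * b) - exp (- A * b) * exp (B * a)"
    define \<alpha> where "\<alpha> = (exp (B * b) - exp (B * a)) / D"
    define \<beta> where "\<beta> = (exp (- A * a) - exp (- A * b)) / D"
    have "exp (- A * b) * exp (B * a) < exp (- A * a) * exp (B * b)"
      using \<open>a < b\<close> assms(1,2) by (intro mult_strict_mono) auto
    then have "D > 0" by (simp add: D_def)
    then have pos: "\<alpha> > 0" "\<beta> > 0"
      unfolding \<alpha>_def \<beta>_def using \<open>a < b\<close> assms(1,2) by auto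
    define k where "k t = \<alpha> * exp (- A * t) + \<beta> * exp (B * t)" for t
    define k' where "k' t = \<beta> * B * exp (B * t) - \<alpha> * A * exp (- A * t)" for t
    have "k a * D = D" "k b * D = D"
      using \<open>D > 0\<close> unfolding k_def \<alpha>_def \<beta>_def by (simp_all add: field_simps) (simp_all add: D_def field_simps)
    then have k1: "k a = 1" "k b = 1" using \<open>D > 0\<close> by auto
    have dk: "(k has_real_derivative k' t) (at t)" for t
      unfolding k_def[abs_def] k'_def by (auto intro!: derivative_eq_intros)
    \<comment> \<open>Both coefficients are positive, so \<open>k\<close> is strictly convex; with
      value 1 at \<open>a\<close> and \<open>b\<close> it is below 1 between them and above 1
      outside.\<close>
    have mono: "k' s < k' t" if "s < t" for s t
    proof -
      have "\<beta> * B * exp (B * s) < \<beta> * B * exp (B * t)" "\<alpha> * A * exp (- A * t) < \<alpha> * A * exp (- A * s)"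
        using that pos assms(1,2) by auto
      then show ?thesis by (simp add: k'_def)
    qed
    obtain z where z: "a < z" "z < b" "k' z = 0"
      using MVT2[OF \<open>a < b\<close> dk] k1 \<open>a < b\<close> by auto
    have dec: "k t < k s" if "s < t" "t \<le> z" for s t
    proof (rule DERIV_neg_imp_decreasing_open[OF that(1)])
      fix u assume "s < u" "u < t"
      then show "\<exists>l. (k has_real_derivative l) (at u) \<and> l < 0"
        using dk[of u] mono[of u z] z that by auto
    qed (use dk in \<open>meson DERIV_continuous_on has_field_derivative_at_within\<close>)
    have inc: "k s < k t" if "s < t" "z \<le> s" for s t
    proof (rule DERIV_pos_imp_increasing_open[OF that(1)])
      fix u assume "s < u" "u < t"
      then show "\<exists>l. (k has_real_derivative l) (at u) \<and> 0 < l"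
        using dk[of u] mono[of z u] z that by auto
    qed (use dk in \<open>meson DERIV_continuous_on has_field_derivative_at_within\<close>)
    have in1: "k t < 1" if "a < t" "t < b" for t
      using dec[of a t] inc[of t b] that k1 by (cases "t \<le> z") auto
    have out1: "k t > 1" if "t < a \<or> b < t" for t
      using dec[of t a] inc[of b t] that k1 z by auto
    have "a \<le> t \<and> t \<le> b" if "t \<in> I" for t
      unfolding a_def b_def using both that by (auto intro: cInf_lower cSup_upper)
    moreover have "t \<in> I" if "a < t" "t < b" for t
      using inI that by (simp add: a_def b_def)
    ultimately show thesis
      using in1 out1 by (intro that[of a b \<alpha> \<beta>]) (force simp: k_def)+
  qed
qed

text \<open>An exponential combination \<open>w\<close> is negative where \<open>h\<close> is
  negative and positive elsewhere, up to two points. Thus \<open>w * h\<close> is nonnegative almost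
  everywhere, while its integral is \<open>- J\<close> because the terms for \<open>p\<close> and
  \<open>r\<close> integrate to 0.\<close>

lemma integral_exp_mult_neg:
  fixes h :: "real \<Rightarrow> real"
  assumes [measurable]: "h \<in> borel_measurable borel"
    and I: "is_interval {t. h t < 0}" and pqr: "p < q" "q < r"
    and hp: "has_bochner_integral lborel (\<lambda>t. exp (p * t) * h t) 0"
    and hr: "has_bochner_integral lborel (\<lambda>t. exp (r * t) * h t) 0"
    and hq: "has_bochner_integral lborel (\<lambda>t. exp (q * t) * h t) J"
  shows "J < 0 \<or> (AE t in lborel. h t = 0)"
proof (cases "\<exists>x y. h x < 0 \<and> h y < 0 \<and> x < y")
  case False
  \<comment> \<open>At most one point has \<open>h\<close> negative, so the vanishing integral for
    \<open>p\<close> alone forces \<open>h\<close> to vanish almost everywhere.\<close>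
  then obtain c where c: "\<And>t. t \<noteq> c \<Longrightarrow> h t \<ge> 0"
    by (meson linorder_neq_iff linorder_not_less)
  have "AE t in lborel. 0 \<le> exp (p * t) * h t"
    using AE_lborel_singleton[of c] by eventually_elim (use c in auto)
  then have "AE t in lborel. exp (p * t) * h t = 0"
    using hp integral_nonneg_eq_0_iff_AE[of lborel "\<lambda>t. exp (p * t) * h t"]
    by (auto simp: has_bochner_integral_iff)
  then show ?thesis by auto
next
  case True
  then obtain x y where xy: "x \<in> {t. h t < 0}" "y \<in> {t. h t < 0}" "x < y" by blast
  obtain \<alpha> \<beta> t\<^sub>1 t\<^sub>2 where k:
    "\<And>t. t \<noteq> t\<^sub>1 \<Longrightarrow> t \<noteq> t\<^sub>2 \<Longrightarrow> t \<in> {t. h t < 0} \<Longrightarrow> \<alpha> * exp (- (q - p) * t) + \<beta> * exp ((r - q) * t) < 1"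
    "\<And>t. t \<noteq> t\<^sub>1 \<Longrightarrow> t \<noteq> t\<^sub>2 \<Longrightarrow> t \<notin> {t. h t < 0} \<Longrightarrow> \<alpha> * exp (- (q - p) * t) + \<beta> * exp ((r - q) * t) > 1"
    by (rule exp_sum_separates_interval[of "q - p" "r - q", OF _ _ I xy]) (use pqr in auto)
  define w where "w t = \<alpha> * exp (p * t) + \<beta> * exp (r * t) - exp (q * t)" for t
  have w: "w t = exp (q * t) * (\<alpha> * exp (- (q - p) * t) + \<beta> * exp ((r - q) * t) - 1)" for t
    by (simp add: w_def algebra_simps flip: exp_add)
  have "has_bochner_integral lborel
    (\<lambda>t. \<alpha> * (exp (p * t) * h t) + \<beta> * (exp (r * t) * h t) - exp (q * t) * h t) (\<alpha> * 0 + \<beta> * 0 - J)"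
    by (intro has_bochner_integral_diff has_bochner_integral_add has_bochner_integral_mult_right hp hq hr)
  then have wh: "has_bochner_integral lborel (\<lambda>t. w t * h t) (- J)"
    by (simp add: w_def algebra_simps)
  have ae: "AE t in lborel. 0 \<le> w t * h t \<and> (w t * h t = 0 \<longrightarrow> h t = 0)"
    using AE_lborel_singleton[of t\<^sub>1] AE_lborel_singleton[of t\<^sub>2]
  proof eventually_elim
    case (elim t)
    show ?case
    proof (cases "h t < 0")
      case True
      then have "w t < 0" using k(1)[OF elim(1,2)] by (simp add: w mult_pos_neg)
      with True show ?thesis by (simp add: mult_neg_neg less_imp_le)
    next
      case False
      then have "w t > 0" using k(2)[OF elim(1,2)] by (simp add: w)
      with False show ?thesis by simp
    qed
  qed
  then have nn: "AE t in lborel. 0 \<le> w t * h t" by auto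
  then have "0 \<le> - J"
    using integral_nonneg_AE[OF nn] has_bochner_integral_integral_eq[OF wh] by simp
  moreover have "AE t in lborel. h t = 0" if "J = 0"
  proof -
    have "AE t in lborel. w t * h t = 0"
      using wh that integral_nonneg_eq_0_iff_AE[OF _ nn] by (auto simp: has_bochner_integral_iff)
    with ae show ?thesis by eventually_elim auto
  qed
  ultimately show ?thesis by linarith
qed

section \<open>The functional \<open>Lambda\<close>\<close>

context prob_space
begin

lemma integrable_exp_iff_exp_prim:
  assumes "q \<noteq> 0"
  shows "integrable M (\<lambda>\<omega>. exp (q * X \<omega>)) \<longleftrightarrow> integrable M (\<lambda>\<omega>. exp_prim q (X \<omega>))"
proof
  assume "integrable M (\<lambda>\<omega>. exp (q * X \<omega>))"
  then have "integrable M (\<lambda>\<omega>. (exp (q * X \<omega>) - 1) / q)" by simp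
  with assms show "integrable M (\<lambda>\<omega>. exp_prim q (X \<omega>))" by (simp add: exp_prim_def)
next
  assume "integrable M (\<lambda>\<omega>. exp_prim q (X \<omega>))"
  then have "integrable M (\<lambda>\<omega>. 1 + q * exp_prim q (X \<omega>))" by simp
  with assms show "integrable M (\<lambda>\<omega>. exp (q * X \<omega>))" by (simp add: exp_prim_def)
qed

lemma expectation_exp_eq_exp_prim:
  assumes "q \<noteq> 0" "integrable M (\<lambda>\<omega>. exp_prim q (X \<omega>))"
  shows "expectation (\<lambda>\<omega>. exp (q * X \<omega>)) = 1 + q * expectation (\<lambda>\<omega>. exp_prim q (X \<omega>))"
proof -
  have "expectation (\<lambda>\<omega>. exp (q * X \<omega>)) = expectation (\<lambda>\<omega>. 1 + q * exp_prim q (X \<omega>))"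
    using assms(1) by (simp add: exp_prim_def)
  with assms(2) show ?thesis by (simp add: prob_space)
qed

text \<open>For nonzero \<open>q\<close> the hypothesis amounts to E exp(qX) = exp(qc), and for
  \<open>q = 0\<close> to E X = c.\<close>

lemma Lambda_eq_of_expectation_exp_prim:
  assumes int: "integrable M (\<lambda>\<omega>. exp_prim q (X \<omega>))"
    and E: "expectation (\<lambda>\<omega>. exp_prim q (X \<omega>)) = exp_prim q c"
  shows "Lambda M X q = ereal c"
proof (cases "q = 0")
  case True
  have X: "integrable M X" using int True by (simp add: exp_prim_def)
  obtain u v where uv: "0 \<le> u" "0 \<le> v"
    "(\<integral>\<^sup>+\<omega>. ennreal (X \<omega>) \<partial>M) = ennreal u" "(\<integral>\<^sup>+\<omega>. ennreal (- X \<omega>) \<partial>M) = ennreal v"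
    using X unfolding real_integrable_def by (metis ennreal_cases infinity_ennreal_def)
  have "c = u - v"
    using E real_lebesgue_integral_def[OF X] uv True by (simp add: exp_prim_def)
  with uv True show ?thesis by (simp add: Lambda_def ext_expectation_def)
next
  case False
  have "(\<integral>\<^sup>+\<omega>. ennreal (exp (q * X \<omega>)) \<partial>M) = ennreal (expectation (\<lambda>\<omega>. exp (q * X \<omega>)))"
    using int False by (intro nn_integral_eq_integral) (auto simp: integrable_exp_iff_exp_prim)
  also have "\<dots> = ennreal (exp (q * c))"
    using expectation_exp_eq_exp_prim[OF False int] E False by (simp add: exp_prim_def)
  finally show ?thesis using False by (simp add: Lambda_def ext_ln_def)
qed

text \<open>For nonzero \<open>q\<close> the function \<open>exp_prim q\<close> is not onto; the
  mean lies in its range because E exp(qX) is strictly positive.\<close>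

lemma expectation_exp_prim_obtain:
  assumes int: "integrable M (\<lambda>\<omega>. exp_prim q (X \<omega>))"
  obtains c where "expectation (\<lambda>\<omega>. exp_prim q (X \<omega>)) = exp_prim q c"
proof (cases "q = 0")
  case False
  let ?m = "expectation (\<lambda>\<omega>. exp (q * X \<omega>))"
  have i: "integrable M (\<lambda>\<omega>. exp (q * X \<omega>))" using int False by (simp add: integrable_exp_iff_exp_prim)
  have "?m \<noteq> 0"
  proof
    assume "?m = 0"
    then have "AE \<omega> in M. exp (q * X \<omega>) = 0"
      using integral_nonneg_eq_0_iff_AE[OF i] by simp
    then show False by (simp add: AE_False)
  qed
  then have "?m > 0" using Bochner_Integration.integral_nonneg[of M "\<lambda>\<omega>. exp (q * X \<omega>)"] by (simp add: less_le)
  then have "expectation (\<lambda>\<omega>. exp_prim q (X \<omega>)) = exp_prim q (ln ?m / q)"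
    using expectation_exp_eq_exp_prim[OF False int] False by (simp add: exp_prim_def field_simps)
  then show thesis by (rule that)
qed (use that in \<open>simp add: exp_prim_def\<close>)

text \<open>An infinite exponential moment makes \<open>Lambda\<close> equal to \<infinity> for
  positive \<open>q\<close> but to -\<infinity> for negative \<open>q\<close>, hence the two
  bounds.\<close>

lemma integrable_exp_prim_of_Lambda_finite:
  assumes [measurable]: "X \<in> borel_measurable M"
    and L: "- \<infinity> < Lambda M X q" "Lambda M X q < \<infinity>"
  shows "integrable M (\<lambda>\<omega>. exp_prim q (X \<omega>))"
proof (cases "q = 0")
  case True
  have "(\<integral>\<^sup>+\<omega>. ennreal (- X \<omega>) \<partial>M) \<noteq> \<infinity>"
    using L(1) True by (auto simp: Lambda_def ext_expectation_def)
  moreover from this have "(\<integral>\<^sup>+\<omega>. ennreal (X \<omega>) \<partial>M) \<noteq> \<infinity>"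
    using L(2) True by (cases "\<integral>\<^sup>+\<omega>. ennreal (- X \<omega>) \<partial>M") (auto simp: Lambda_def ext_expectation_def)
  ultimately have "integrable M X" by (simp add: real_integrable_def)
  with True show ?thesis by (simp add: exp_prim_def)
next
  case False
  let ?m = "\<integral>\<^sup>+\<omega>. ennreal (exp (q * X \<omega>)) \<partial>M"
  have "?m \<noteq> \<infinity>"
  proof
    assume "?m = \<infinity>"
    then have "Lambda M X q = ereal (1 / q) * \<infinity>" using False by (simp add: Lambda_def ext_ln_def)
    with L False show False by (cases "q > 0") auto
  qed
  then have "integrable M (\<lambda>\<omega>. exp (q * X \<omega>))"
    by (intro integrableI_nonneg) (auto simp: top.not_eq_extremum)
  with False show ?thesis by (simp add: integrable_exp_iff_exp_prim)
qed

text \<open>Monotonicity in the parameter squeezes \<open>exp_prim q\<close> pointwise between two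
  integrable functions.\<close>

lemma integrable_exp_prim_between:
  assumes [measurable]: "X \<in> borel_measurable M"
    and "integrable M (\<lambda>\<omega>. exp_prim p (X \<omega>))" "integrable M (\<lambda>\<omega>. exp_prim r (X \<omega>))"
    and "p \<le> q" "q \<le> r"
  shows "integrable M (\<lambda>\<omega>. exp_prim q (X \<omega>))"
proof (rule Bochner_Integration.integrable_bound)
  show "integrable M (\<lambda>\<omega>. \<bar>exp_prim p (X \<omega>)\<bar> + \<bar>exp_prim r (X \<omega>)\<bar>)" using assms by auto
  show "AE \<omega> in M. norm (exp_prim q (X \<omega>)) \<le> norm (\<bar>exp_prim p (X \<omega>)\<bar> + \<bar>exp_prim r (X \<omega>)\<bar>)"
  proof (rule AE_I2)
    fix \<omega>
    have "exp_prim p (X \<omega>) \<le> exp_prim q (X \<omega>)" "exp_prim q (X \<omega>) \<le> exp_prim r (X \<omega>)"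
      using assms by (auto intro: exp_prim_le_param)
    then show "norm (exp_prim q (X \<omega>)) \<le> norm (\<bar>exp_prim p (X \<omega>)\<bar> + \<bar>exp_prim r (X \<omega>)\<bar>)"
      by (auto simp: abs_le_iff)
  qed
qed measurable

lemma exp_mean_strict_mono_or_const:
  assumes [measurable]: "X \<in> borel_measurable M"
    and ip: "integrable M (\<lambda>\<omega>. exp_prim p (X \<omega>))" and ir: "integrable M (\<lambda>\<omega>. exp_prim r (X \<omega>))"
    and Ep: "expectation (\<lambda>\<omega>. exp_prim p (X \<omega>)) = exp_prim p c"
    and Er: "expectation (\<lambda>\<omega>. exp_prim r (X \<omega>)) = exp_prim r d"
    and "p < r"
  shows "c < d \<or> (AE \<omega> in M. X \<omega> = c)"
proof -
  \<comment> \<open>The factor \<open>exp ((r - p) * c)\<close> cancels the first-order terms at X =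
    c, so \<open>f\<close> is nonnegative and vanishes only where X = c. The subtracted term has
    expectation 0 by the choice of \<open>c\<close>.\<close>
  define f where "f \<omega> = (exp_prim r (X \<omega>) - exp_prim r c) - exp ((r - p) * c) * (exp_prim p (X \<omega>) - exp_prim p c)" for \<omega>
  have f: "f \<omega> = exp (r * c) * (exp_prim r (X \<omega> - c) - exp_prim p (X \<omega> - c))" for \<omega>
  proof -
    have "exp ((r - p) * c) * exp (p * c) = exp (r * c)"
      unfolding exp_add[symmetric] by (simp add: algebra_simps)
    then show ?thesis
      using exp_prim_shift[of r "X \<omega>" c] exp_prim_shift[of p "X \<omega>" c]
      by (simp add: f_def right_diff_distrib flip: mult.assoc)
  qed
  have nn: "AE \<omega> in M. 0 \<le> f \<omega>"
    using \<open>p < r\<close> by (auto simp: f exp_prim_le_param)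
  have fi: "integrable M f" unfolding f_def[abs_def] using ip ir by auto
  have Ef: "expectation f = exp_prim r d - exp_prim r c"
    unfolding f_def[abs_def] using ip ir Ep Er by (simp add: prob_space)
  then have "c \<le> d" using integral_nonneg_AE[OF nn] by (simp add: exp_prim_le_iff)
  moreover have "AE \<omega> in M. X \<omega> = c" if "c = d"
  proof -
    have "AE \<omega> in M. f \<omega> = 0" using Ef that integral_nonneg_eq_0_iff_AE[OF fi nn] by simp
    then show ?thesis
    proof eventually_elim
      case (elim \<omega>)
      then show ?case using exp_prim_less_param[OF \<open>p < r\<close>, of "X \<omega> - c"] by (auto simp: f)
    qed
  qed
  ultimately show ?thesis by linarith
qed

end

section \<open>Comparison with Gaussian laws\<close>

lemma Phi_gt_0_less_1: "0 < Phi x" "Phi x < 1"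
  using bij_betw_Phi by (auto simp: bij_betw_def)

lemma Phi_inv_Phi: "Phi_inv (Phi x) = ereal x"
  using bij_betw_Phi Phi_gt_0_less_1[of x] by (simp add: Phi_inv_def bij_betw_def)

lemma Phi_less_iff: "Phi x < Phi y \<longleftrightarrow> x < y"
  by (rule strict_mono_less[OF strict_mono_Phi])

lemma Phi_obtain:
  assumes "0 < u" "u < 1"
  obtains x where "u = Phi x"
  using assms bij_betw_Phi by (force simp: bij_betw_def)

text \<open>Translates the sign of a difference of distribution functions into a comparison of an
  affine function with a concave one. The infinite values of \<open>Phi_inv\<close> fit because
  \<open>Phi x\<close> lies strictly between 0 and 1.\<close>

lemma less_Phi_inv_iff: "ereal x < Phi_inv u \<longleftrightarrow> Phi x < u"
proof -
  consider "u \<le> 0" | "1 \<le> u" | "0 < u" "u < 1" by linarith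
  then show ?thesis
  proof cases
    case 3
    then obtain y where "u = Phi y" by (rule Phi_obtain)
    then show ?thesis by (simp add: Phi_inv_Phi Phi_less_iff)
  qed (use Phi_gt_0_less_1[of x] in \<open>auto simp: Phi_inv_def\<close>)
qed

lemma Phi_inv_gt_MInf_iff: "- \<infinity> < Phi_inv u \<longleftrightarrow> 0 < u"
  by (auto simp: Phi_inv_def)

lemma Phi_inv_eq_PInf_iff: "Phi_inv u = \<infinity> \<longleftrightarrow> 1 \<le> u"
  by (auto simp: Phi_inv_def)

lemma ext_concaveD:
  assumes "ext_concave G" "0 < l" "l < 1" "- \<infinity> < G s" "- \<infinity> < G t"
  shows "ereal (1 - l) * G s + ereal l * G t \<le> G ((1 - l) * s + l * t)"
  using assms unfolding ext_concave_def by auto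

lemma is_interval_affine_less_concave:
  assumes G: "ext_concave G" and "a > 0"
  shows "is_interval {t. ereal ((t - b) / a) < G t}"
  unfolding is_interval_1
proof (intro ballI allI impI, unfold mem_Collect_eq)
  fix s t x :: real
  assume s: "ereal ((s - b) / a) < G s" and t: "ereal ((t - b) / a) < G t" and x: "s \<le> x \<and> x \<le> t"
  show "ereal ((x - b) / a) < G x"
  proof (cases "x = s \<or> x = t")
    case False
    define l where "l = (x - s) / (t - s)"
    have l: "0 < l" "l < 1" using False x by (auto simp: l_def field_simps)
    have xl: "x = (1 - l) * s + l * t"
    proof -
      have "l * (t - s) = x - s" using False x by (simp add: l_def)
      then show ?thesis by (simp add: algebra_simps)
    qed
    have "ereal ((x - b) / a) < ereal (1 - l) * G s + ereal l * G t"
    \<comment> \<open>The strict inequalities exclude -\<infinity>, and a value \<infinity> at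
      either end makes the right side infinite.\<close>
    proof (cases "G s"; cases "G t")
      fix u v assume uv: "G s = ereal u" "G t = ereal v"
      have "(1 - l) * ((s - b) / a) < (1 - l) * u" "l * ((t - b) / a) < l * v"
        using s t uv l by (intro mult_strict_left_mono; simp)+
      moreover have "(x - b) / a = (1 - l) * ((s - b) / a) + l * ((t - b) / a)"
        using \<open>a > 0\<close> unfolding xl by (simp add: field_simps)
      ultimately show ?thesis using uv by simp
    qed (use s t l in auto)
    also have "\<dots> \<le> G x"
      unfolding xl by (rule ext_concaveD[OF G l]) (use s t in auto)
    finally show ?thesis .
  qed (use s t in auto)
qed

section \<open>Left tails, and comparison with a Gaussian at an intermediate exponent\<close>

context prob_space
begin

lemma prob_less_mono:
  assumes [measurable]: "X \<in> borel_measurable M" and "s \<le> t"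
  shows "prob_less M X s \<le> prob_less M X t"
  using assms(2) by (intro finite_measure_mono) auto

lemma prob_less_obtain_small:
  assumes [measurable]: "X \<in> borel_measurable M" and "0 < e"
  obtains s where "s < u" "prob_less M X s < e"
proof -
  interpret D: real_distribution "distr M borel X" by (rule real_distribution_distr) fact
  have "\<forall>\<^sub>F s in at_bot. cdf (distr M borel X) s < e"
    by (rule order_tendstoD(2)[OF D.cdf_lim_at_bot \<open>0 < e\<close>])
  moreover have "\<forall>\<^sub>F s in at_bot. s < u" by (rule eventually_gt_at_bot)
  ultimately have "\<forall>\<^sub>F s in at_bot. s < u \<and> cdf (distr M borel X) s < e"
    by (rule eventually_conj[rotated])
  then obtain s where s: "s < u" "cdf (distr M borel X) s < e"
    by (auto simp: eventually_at_bot_linorder)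
  have "prob_less M X s \<le> cdf (distr M borel X) s"
    unfolding cdf_def by (subst measure_distr) (auto intro!: finite_measure_mono)
  with s that show thesis by fastforce
qed

text \<open>Outside the interval between two points, a concave function lies below the line through
  its values there. Applied to \<open>Phi_inv (prob_less M X t)\<close> at some \<open>s < 0\<close>
  and at 0, this bounds the left tail by a Gaussian one.\<close>

lemma prob_less_le_gaussian:
  assumes X: "X \<in> borel_measurable M"
    and G: "ext_concave (\<lambda>t. Phi_inv (prob_less M X t))"
    and pos: "\<And>t. 0 < prob_less M X t"
  obtains a b s where "0 < a" "\<And>t. t \<le> s \<Longrightarrow> prob_less M X t \<le> Phi ((t - b) / a)"
proof -
  let ?F = "prob_less M X"
  have gt: "- \<infinity> < Phi_inv (?F t)" for t
    unfolding Phi_inv_gt_MInf_iff by (rule pos)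
  \<comment> \<open>Otherwise concavity would spread the value \<infinity> from 0 to the midpoint
    \<open>s\<close> of \<open>2 * s\<close> and 0, although \<open>?F s < 1\<close>.\<close>
  have "?F 0 < 1"
  proof (rule ccontr)
    assume "\<not> ?F 0 < 1"
    then have inf: "Phi_inv (?F 0) = \<infinity>" by (simp add: Phi_inv_eq_PInf_iff)
    obtain s where "s < 0" "?F s < 1" using prob_less_obtain_small[OF X, of 1 0] by auto
    have "ereal (1 - 1/2) * Phi_inv (?F (2 * s)) + ereal (1/2) * Phi_inv (?F 0)
        \<le> Phi_inv (?F ((1 - 1/2) * (2 * s) + 1/2 * 0))"
      by (rule ext_concaveD[OF G]) (use gt in auto)
    then have "Phi_inv (?F s) = \<infinity>"
      using gt[of "2 * s"] inf by (cases "Phi_inv (?F (2 * s))") auto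
    with \<open>?F s < 1\<close> show False by (simp add: Phi_inv_eq_PInf_iff)
  qed
  then obtain y\<^sub>0 where y0: "?F 0 = Phi y\<^sub>0" using pos Phi_obtain by metis
  obtain s where s: "s < 0" "?F s < ?F 0" using prob_less_obtain_small[OF X pos] by metis
  then obtain y\<^sub>1 where y1: "?F s = Phi y\<^sub>1" using pos \<open>?F 0 < 1\<close> Phi_obtain by (metis less_trans)
  have "y\<^sub>1 < y\<^sub>0" using s y0 y1 by (simp add: Phi_less_iff)
  \<comment> \<open>The reciprocal slope of the line through (\<open>s\<close>,
    \<open>y\<^sub>1\<close>) and (0, \<open>y\<^sub>0\<close>); its zero
    \<open>- a * y\<^sub>0\<close> becomes the mean.\<close>
  define a where "a = - s / (y\<^sub>0 - y\<^sub>1)"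
  have "0 < a" unfolding a_def using s \<open>y\<^sub>1 < y\<^sub>0\<close> by (intro divide_pos_pos) auto
  have line: "(t - (- a * y\<^sub>0)) / a = t * (y\<^sub>1 - y\<^sub>0) / s + y\<^sub>0" for t
    using s \<open>y\<^sub>1 < y\<^sub>0\<close> \<open>0 < a\<close> by (simp add: a_def field_simps)
  have "?F t \<le> Phi ((t - (- a * y\<^sub>0)) / a)" if "t \<le> s" for t
  proof (cases "t = s")
    case True
    then show ?thesis using s y1 unfolding line by simp
  next
    case False
    with that have "t < s" by simp
    then have "?F t < 1" using prob_less_mono[OF X, of t s] s \<open>?F 0 < 1\<close> by linarith
    then obtain y where y: "?F t = Phi y" using pos Phi_obtain by metis
    define l where "l = 1 - s / t"
    have l: "0 < l" "l < 1" "(1 - l) * t + l * 0 = s"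
      using \<open>t < s\<close> s by (auto simp: l_def field_simps)
    have "ereal (1 - l) * Phi_inv (?F t) + ereal l * Phi_inv (?F 0) \<le> Phi_inv (?F ((1 - l) * t + l * 0))"
      by (rule ext_concaveD[OF G]) (use gt l in auto)
    then have "(1 - l) * y + l * y\<^sub>0 \<le> y\<^sub>1"
      unfolding l(3) y y0 y1 Phi_inv_Phi by simp
    then have "s / t * (y - y\<^sub>0) \<le> y\<^sub>1 - y\<^sub>0"
      by (simp add: l_def algebra_simps diff_divide_distrib)
    moreover have "0 < t / s" using \<open>t < s\<close> s by (simp add: zero_less_divide_iff)
    ultimately have "t / s * (s / t * (y - y\<^sub>0)) \<le> t / s * (y\<^sub>1 - y\<^sub>0)"
      by (intro mult_left_mono) auto
    then have "y \<le> t * (y\<^sub>1 - y\<^sub>0) / s + y\<^sub>0" using \<open>t < s\<close> s by simp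
    then show ?thesis
      unfolding line y using strict_mono_less_eq[OF strict_mono_Phi] by blast
  qed
  with \<open>0 < a\<close> show thesis by (rule that)
qed

text \<open>Either X is almost surely bounded below, or its distribution function is dominated by a
  Gaussian one plus that of a constant; both of these have finite moments.\<close>

lemma nn_integral_exp_neg_finite:
  assumes X [measurable]: "X \<in> borel_measurable M"
    and G: "ext_concave (\<lambda>t. Phi_inv (prob_less M X t))" and p: "p < 0"
  shows "(\<integral>\<^sup>+\<omega>. ennreal (exp (p * X \<omega>)) \<partial>M) < \<infinity>"
proof (cases "\<forall>t. 0 < prob_less M X t")
  case False
  then obtain c where "prob_less M X c = 0" by (metis measure_nonneg order_le_less)
  then have "AE \<omega> in M. \<not> X \<omega> < c"
    by (subst AE_iff_measurable[where N = "{\<omega>\<in>space M. X \<omega> < c}"]) (auto simp: emeasure_eq_measure)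
  then have "(\<integral>\<^sup>+\<omega>. ennreal (exp (p * X \<omega>)) \<partial>M) \<le> (\<integral>\<^sup>+\<omega>. ennreal (exp (p * c)) \<partial>M)"
    by (intro nn_integral_mono_AE, eventually_elim) (use p in auto)
  also have "\<dots> < \<infinity>" by (simp add: emeasure_space_1)
  finally show ?thesis .
next
  case True
  let ?N = "std_normal_distribution"
  interpret N: prob_space ?N by (rule prob_space_normal_density) simp
  obtain a b s where "0 < a" and le: "\<And>t. t \<le> s \<Longrightarrow> prob_less M X t \<le> Phi ((t - b) / a)"
    using prob_less_le_gaussian[OF X G] True by metis
  let ?e = "\<lambda>t. ennreal (- p * exp (p * t))"
  have bound: "ennreal (prob_less M X t) \<le>
    ennreal (prob_less ?N (\<lambda>z. a * z + b) t) + ennreal (prob_less M (\<lambda>_. s) t)" for t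
  proof (cases "t \<le> s")
    case True
    then show ?thesis
      using le[OF True] by (simp add: prob_less_gaussian[OF \<open>0 < a\<close>] ennreal_leI del: space_density)
  next
    case False
    then have "prob_less M (\<lambda>_. s) t = 1" by (simp add: prob_space)
    then have "ennreal (prob_less M X t) \<le> ennreal (prob_less M (\<lambda>_. s) t)"
      by (intro ennreal_leI) simp
    then show ?thesis by (rule order_trans) simp
  qed
  have Y: "(\<lambda>z. a * z + b) \<in> borel_measurable ?N" by simp
  have m: "(\<lambda>t. ennreal (prob_less ?N (\<lambda>z. a * z + b) t)) \<in> borel_measurable borel"
    "(\<lambda>t. ennreal (prob_less M (\<lambda>_. s) t)) \<in> borel_measurable borel"
    by (intro measurable_compose[OF borel_measurable_mono measurable_ennreal] monoI
        N.prob_less_mono[OF Y] prob_less_mono; simp)+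
  have "integrable ?N (\<lambda>z. exp_prim p (a * z + b))"
    using has_bochner_integral_exp_prim_gaussian by (auto simp: has_bochner_integral_iff)
  then have "integrable ?N (\<lambda>z. exp (p * (a * z + b)))"
    using N.integrable_exp_iff_exp_prim[of p "\<lambda>z. a * z + b"] p by blast
  then have fin: "(\<integral>\<^sup>+z. ennreal (exp (p * (a * z + b))) \<partial>?N) < \<infinity>"
    by (simp add: integrable_iff_bounded)
  have "(\<integral>\<^sup>+\<omega>. ennreal (exp (p * X \<omega>)) \<partial>M) = (\<integral>\<^sup>+t. ?e t * ennreal (prob_less M X t) \<partial>lborel)"
    by (rule nn_integral_exp_neg[OF X p])
  also have "\<dots> \<le> (\<integral>\<^sup>+t. ?e t * ennreal (prob_less ?N (\<lambda>z. a * z + b) t)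
      + ?e t * ennreal (prob_less M (\<lambda>_. s) t) \<partial>lborel)"
    unfolding distrib_left[symmetric] by (intro nn_integral_mono mult_left_mono bound) simp
  also have "\<dots> = (\<integral>\<^sup>+t. ?e t * ennreal (prob_less ?N (\<lambda>z. a * z + b) t) \<partial>lborel)
      + (\<integral>\<^sup>+t. ?e t * ennreal (prob_less M (\<lambda>_. s) t) \<partial>lborel)"
    by (intro nn_integral_add borel_measurable_times_ennreal) (use m in \<open>simp_all del: space_density\<close>)
  also have "\<dots> = (\<integral>\<^sup>+z. ennreal (exp (p * (a * z + b))) \<partial>?N) + (\<integral>\<^sup>+\<omega>. ennreal (exp (p * s)) \<partial>M)"
    using N.nn_integral_exp_neg[OF Y p] nn_integral_exp_neg[of "\<lambda>_. s", OF _ p] by simp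
  also have "\<dots> < \<infinity>" using fin by (simp add: emeasure_space_1)
  finally show ?thesis .
qed

lemma exp_prim_expectation_less_gaussian:
  assumes X [measurable]: "X \<in> borel_measurable M"
    and G: "ext_concave (\<lambda>t. Phi_inv (prob_less M X t))"
    and "0 < a" "p < q" "q < r"
    and ip: "integrable M (\<lambda>\<omega>. exp_prim p (X \<omega>))" and ir: "integrable M (\<lambda>\<omega>. exp_prim r (X \<omega>))"
    and Ep: "expectation (\<lambda>\<omega>. exp_prim p (X \<omega>)) = exp_prim p (b + a\<^sup>2 * p / 2)"
    and Er: "expectation (\<lambda>\<omega>. exp_prim r (X \<omega>)) = exp_prim r (b + a\<^sup>2 * r / 2)"
  shows "expectation (\<lambda>\<omega>. exp_prim q (X \<omega>)) < exp_prim q (b + a\<^sup>2 * q / 2) \<or>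
    (gaussian M X \<and> expectation (\<lambda>\<omega>. exp_prim q (X \<omega>)) = exp_prim q (b + a\<^sup>2 * q / 2))"
proof -
  interpret N: prob_space std_normal_distribution by (rule prob_space_normal_density) simp
  define h where "h t = Phi ((t - b) / a) - prob_less M X t" for t
  have "mono (prob_less M X)" by (intro monoI prob_less_mono X)
  moreover have "mono (\<lambda>t. Phi ((t - b) / a))"
    using \<open>0 < a\<close> by (intro monoI) (simp add: strict_mono_less_eq[OF strict_mono_Phi] divide_right_mono)
  ultimately have h_meas: "h \<in> borel_measurable borel"
    unfolding h_def[abs_def] by (intro borel_measurable_diff borel_measurable_mono)
  have "{t. h t < 0} = {t. ereal ((t - b) / a) < Phi_inv (prob_less M X t)}"
    by (simp add: h_def less_Phi_inv_iff)
  with is_interval_affine_less_concave[OF G \<open>0 < a\<close>] have I: "is_interval {t. h t < 0}"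
    by simp
  have h: "has_bochner_integral lborel (\<lambda>t. exp (s * t) * h t)
      (expectation (\<lambda>\<omega>. exp_prim s (X \<omega>)) - exp_prim s (b + a\<^sup>2 * s / 2))"
    if "integrable M (\<lambda>\<omega>. exp_prim s (X \<omega>))" for s
  proof -
    note g = has_bochner_integral_exp_prim_gaussian[of s a b]
    have "has_bochner_integral lborel (\<lambda>t. exp (s * t) * (indicator {0<..} t - Phi ((t - b) / a)))
      (exp_prim s (b + a\<^sup>2 * s / 2))"
      using N.has_bochner_integral_tail_exp_prim[of "\<lambda>z. a * z + b" s] g
        has_bochner_integral_integral_eq[OF g]
      by (simp add: prob_less_gaussian[OF \<open>0 < a\<close>] has_bochner_integral_iff del: space_density)
    from has_bochner_integral_diff[OF has_bochner_integral_tail_exp_prim[OF X that] this]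
    show ?thesis by (simp add: h_def algebra_simps)
  qed
  have iq: "integrable M (\<lambda>\<omega>. exp_prim q (X \<omega>))"
    using integrable_exp_prim_between[OF X ip ir] \<open>p < q\<close> \<open>q < r\<close> by simp
  let ?J = "expectation (\<lambda>\<omega>. exp_prim q (X \<omega>)) - exp_prim q (b + a\<^sup>2 * q / 2)"
  have "?J < 0 \<or> (AE t in lborel. h t = 0)"
    by (rule integral_exp_mult_neg[OF h_meas I \<open>p < q\<close> \<open>q < r\<close> _ _ h[OF iq]])
      (use h[OF ip] h[OF ir] Ep Er in auto)
  moreover have "gaussian M X \<and> ?J = 0" if ae: "AE t in lborel. h t = 0"
  proof
    show "gaussian M X"
      by (rule gaussianI[OF X \<open>0 < a\<close>, of b]) (use ae in \<open>auto simp: h_def\<close>)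
    have "(\<integral>t. exp (q * t) * h t \<partial>lborel) = 0"
      by (rule integral_eq_zero_AE) (use ae in auto)
    with has_bochner_integral_integral_eq[OF h[OF iq]] show "?J = 0" by simp
  qed
  ultimately show ?thesis by auto
qed

text \<open>For positive \<open>p\<close> it suffices that the moment is nonzero, for negative
  \<open>p\<close> that it is finite. For \<open>p = 0\<close> the bound -x \<le> exp(-x) controls
  the negative part by the moment at -1.\<close>

lemma Lambda_gt_MInf:
  assumes X [measurable]: "X \<in> borel_measurable M"
    and G: "ext_concave (\<lambda>t. Phi_inv (prob_less M X t))"
  shows "- \<infinity> < Lambda M X p"
proof -
  let ?m = "\<lambda>p. \<integral>\<^sup>+\<omega>. ennreal (exp (p * X \<omega>)) \<partial>M"
  have fin: "?m p < \<infinity>" if "p < 0" for p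
    by (rule nn_integral_exp_neg_finite[OF X G that])
  have nz: "?m p \<noteq> 0" for p
    by (subst nn_integral_0_iff_AE) (auto simp: AE_False)
  consider "p = 0" | "p < 0" | "0 < p" by linarith
  then show ?thesis
  proof cases
    case 1
    have "(\<integral>\<^sup>+\<omega>. ennreal (- X \<omega>) \<partial>M) \<le> ?m (- 1)"
    proof (intro nn_integral_mono ennreal_leI)
      fix \<omega>
      show "- X \<omega> \<le> exp (- 1 * X \<omega>)" using exp_ge_add_one_self[of "- X \<omega>"] by simp
    qed
    also have "\<dots> < \<infinity>" by (rule fin) simp
    finally obtain v where "(\<integral>\<^sup>+\<omega>. ennreal (- X \<omega>) \<partial>M) = ennreal v" "0 \<le> v"
      by (cases "\<integral>\<^sup>+\<omega>. ennreal (- X \<omega>) \<partial>M") auto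
    with 1 show ?thesis
      by (cases "\<integral>\<^sup>+\<omega>. ennreal (X \<omega>) \<partial>M") (auto simp: Lambda_def ext_expectation_def)
  next
    case 2
    then show ?thesis using fin[OF 2] nz[of p] by (simp add: Lambda_def ext_ln_def)
  next
    case 3
    then show ?thesis using nz[of p] by (simp add: Lambda_def ext_ln_def)
  qed
qed

text \<open>The chord of \<open>Lambda\<close> over [p, r] is the graph of \<open>Lambda\<close> for
  a Gaussian law, so the comparison at \<open>q\<close> is the claim. Finiteness of \<open>R\<close>
  later gives convexity of the domain.\<close>

lemma Lambda_convex_combination:
  assumes X: "X \<in> borel_measurable M"
    and G: "ext_concave (\<lambda>t. Phi_inv (prob_less M X t))"
    and "p < r" "0 < l" "l < 1" "Lambda M X p < \<infinity>" "Lambda M X r < \<infinity>"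
  defines "R \<equiv> ereal (1 - l) * Lambda M X p + ereal l * Lambda M X r"
  shows "R < \<infinity> \<and> (Lambda M X ((1 - l) * p + l * r) < R \<or>
    gaussian M X \<and> Lambda M X ((1 - l) * p + l * r) = R)"
proof -
  define q where "q = (1 - l) * p + l * r"
  have "q - p = l * (r - p)" "r - q = (1 - l) * (r - p)" by (simp_all add: q_def algebra_simps)
  then have "p < q" "q < r"
    using assms(3-5) mult_pos_pos[of l "r - p"] mult_pos_pos[of "1 - l" "r - p"] by linarith+
  have int: "integrable M (\<lambda>\<omega>. exp_prim p (X \<omega>))" "integrable M (\<lambda>\<omega>. exp_prim r (X \<omega>))"
    using assms by (auto intro!: integrable_exp_prim_of_Lambda_finite Lambda_gt_MInf)
  then have iq: "integrable M (\<lambda>\<omega>. exp_prim q (X \<omega>))"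
    using integrable_exp_prim_between[OF X int] \<open>p < q\<close> \<open>q < r\<close> by simp
  obtain c where c: "expectation (\<lambda>\<omega>. exp_prim p (X \<omega>)) = exp_prim p c"
    by (rule expectation_exp_prim_obtain[OF int(1)])
  obtain d where d: "expectation (\<lambda>\<omega>. exp_prim r (X \<omega>)) = exp_prim r d"
    by (rule expectation_exp_prim_obtain[OF int(2)])
  obtain e where e: "expectation (\<lambda>\<omega>. exp_prim q (X \<omega>)) = exp_prim q e"
    by (rule expectation_exp_prim_obtain[OF iq])
  have L: "Lambda M X p = ereal c" "Lambda M X r = ereal d" "Lambda M X q = ereal e"
    using Lambda_eq_of_expectation_exp_prim int iq c d e by auto
  then have R: "R = ereal ((1 - l) * c + l * d)" by (simp add: R_def)
  have "e < (1 - l) * c + l * d \<or> gaussian M X \<and> e = (1 - l) * c + l * d"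
  \<comment> \<open>For constant X the chord is horizontal and the matching Gaussian degenerates, so
    this case is computed directly.\<close>
  proof (cases "AE \<omega> in M. X \<omega> = c")
    case True
    have "expectation (\<lambda>\<omega>. exp_prim s (X \<omega>)) = exp_prim s c" for s
    proof -
      have "expectation (\<lambda>\<omega>. exp_prim s (X \<omega>)) = expectation (\<lambda>\<omega>. exp_prim s c)"
        using True X by (intro integral_cong_AE) auto
      then show ?thesis by (simp add: prob_space)
    qed
    with d e have "d = c" "e = c" by (auto simp: exp_prim_eq_iff)
    then show ?thesis using gaussian_of_AE_const[OF X True] by (simp add: algebra_simps)
  next
    case False
    then have "c < d"
      using exp_mean_strict_mono_or_const[OF X int c d \<open>p < r\<close>] by auto
    \<comment> \<open>Chosen so that the line with slope \<open>a\<^sup>2 / 2\<close> and intercept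
      \<open>b\<close> passes through (\<open>p\<close>, \<open>c\<close>) and (\<open>r\<close>,
      \<open>d\<close>).\<close>
    define a where "a = sqrt (2 * (d - c) / (r - p))"
    define b where "b = c - a\<^sup>2 * p / 2"
    have "0 < a" using \<open>c < d\<close> \<open>p < r\<close> by (simp add: a_def)
    have a2: "a\<^sup>2 * (r - p) = 2 * (d - c)"
      using \<open>c < d\<close> \<open>p < r\<close> by (simp add: a_def)
    have bp: "b + a\<^sup>2 * p / 2 = c" by (simp add: b_def)
    have br: "b + a\<^sup>2 * r / 2 = d" using a2 by (simp add: b_def field_simps)
    have bq: "b + a\<^sup>2 * q / 2 = (1 - l) * c + l * d"
      unfolding bp[symmetric] br[symmetric] q_def by (simp add: field_simps)
    have "expectation (\<lambda>\<omega>. exp_prim q (X \<omega>)) < exp_prim q (b + a\<^sup>2 * q / 2) \<or>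
      (gaussian M X \<and> expectation (\<lambda>\<omega>. exp_prim q (X \<omega>)) = exp_prim q (b + a\<^sup>2 * q / 2))"
      by (rule exp_prim_expectation_less_gaussian[OF X G \<open>0 < a\<close> \<open>p < q\<close> \<open>q < r\<close> int])
        (simp_all add: bp br c d)
    then show ?thesis by (simp add: e bq exp_prim_less_iff exp_prim_eq_iff)
  qed
  then show ?thesis by (simp add: R L flip: q_def)
qed

end

section \<open>Convexity and strict convexity of \<open>Lambda\<close>\<close>

theorem theorem1p1:
  fixes M :: "'a measure" and X :: "'a \<Rightarrow> real"
  assumes "prob_space M"
    and "X \<in> borel_measurable M"
    and "ext_concave (\<lambda>t. Phi_inv (measure M {\<omega> \<in> space M. X \<omega> < t}))"
  shows "(\<forall>p. Lambda M X p > - \<infinity>) \<and>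
    ext_convex (Lambda M X) \<and>
    (\<not> gaussian M X \<longrightarrow> ext_strictly_convex_on {p. Lambda M X p < \<infinity>} (Lambda M X))"
proof -
  interpret prob_space M by fact
  let ?L = "Lambda M X"
  let ?R = "\<lambda>l p r. ereal (1 - l) * ?L p + ereal l * ?L r"
  have gt: "- \<infinity> < ?L p" for p by (rule Lambda_gt_MInf[OF assms(2,3)])
  have main: "?R l p r < \<infinity> \<and> (?L ((1 - l) * p + l * r) < ?R l p r \<or>
      gaussian M X \<and> ?L ((1 - l) * p + l * r) = ?R l p r)"
    if "p \<noteq> r" "0 < l" "l < 1" "?L p < \<infinity>" "?L r < \<infinity>" for p r l
  proof (cases "p < r")
    case True
    then show ?thesis using Lambda_convex_combination[OF assms(2,3) True] that by blast
  next
    case False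
    with that have "r < p" by simp
    from Lambda_convex_combination[OF assms(2,3) this, of "1 - l"] that
    show ?thesis by (simp add: add.commute)
  qed
  \<comment> \<open>Convexity also quantifies over equal endpoints, which the strict comparison
    leaves out.\<close>
  have diag: "?R l p p = ?L p" "(1 - l) * p + l * p = p" if "?L p < \<infinity>" for p l
    using that gt[of p] by (cases "?L p"; simp add: algebra_simps)+
  have le: "?L ((1 - l) * p + l * r) \<le> ?R l p r \<and> ?L ((1 - l) * p + l * r) < \<infinity>"
    if "0 < l" "l < 1" "?L p < \<infinity>" "?L r < \<infinity>" for p r l
    using main[of p r l] diag[of p l] that by (cases "p = r") auto
  have conv: "convex {p. ?L p < \<infinity>}"
    unfolding convex_alt
  proof (intro ballI allI impI, unfold mem_Collect_eq real_scaleR_def)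
    fix p r l :: real
    assume "?L p < \<infinity>" "?L r < \<infinity>" "0 \<le> l \<and> l \<le> 1"
    then show "?L ((1 - l) * p + l * r) < \<infinity>"
      using le[of l p r] by (cases "l = 0"; cases "l = 1") auto
  qed
  have "ext_convex ?L" unfolding ext_convex_def using le by auto
  moreover have "ext_strictly_convex_on {p. ?L p < \<infinity>} ?L" if "\<not> gaussian M X"
    unfolding ext_strictly_convex_on_def using conv main that by auto
  ultimately show ?thesis using gt by blast
qed

end
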